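(* Suppose $\mathcal F$ is the unit $\ell_1$ ball of $\mathbb R^N$, $\mathcal X$ is the dual unit $\ell_\infty$ ball of $\mathbb R^N$, the loss is $\ell(f,x)=\langle f,x\rangle$, and $D$ is any symmetric distribution on the real line with $0<\mathbb E_{x\sim D}|x|<\infty$. Consider the randomized algorithm that at each round $t$ freshly draws Rademacher random variables $\epsilon_{t+1},\dots,\epsilon_T$ and freshly draws $x_{t+1},\dots,x_T\sim D^N$ (each coordinate drawn independently from $D$) and picks $$f_t=\operatorname*{argmin}_{f\in\mathcal F}\Big\langle f,\ \sum_{i=1}^{t-1}x_i-C\sum_{i=t+1}^T\epsilon_ix_i\Big\rangle,\qquad C=\frac{6}{\mathbb E_{x\sim D}|x|},$$ where $x_1,\dots,x_{t-1}$ are Nature's past moves. Then the expected regret satisfies $$\mathbb E[\mathbf{Reg}_T]\le C\,\mathbb E_{x_{1:T}\sim D^N}\mathbb E_\epsilon\Big\|\sum_{t=1}^T\epsilon_tx_t\Big\|_\infty+4\sum_{t=1}^T\mathbb P_{y_{t+1},\dots,y_T\sim D}\Big(C\Big|\sum_{i=t+1}^Ty_i\Big|\le4\Big).$$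
   Context: Online linear optimization: on each round $t=1,\dots,T$ the learner picks $f_t\in\mathcal F$ (randomized) and Nature simultaneously picks $x_t\in\mathcal X$ (Nature may depend on the past moves of both players but not on the learner's fresh randomness of round $t$). $\mathbf{Reg}_T=\sum_{t=1}^T\langle f_t,x_t\rangle-\inf_{f\in\mathcal F}\sum_{t=1}^T\langle f,x_t\rangle$. $y_{t+1},\dots,y_T$ are i.i.d. from $D$; $\epsilon$ denotes i.i.d. Rademacher variables. *)

theory Defs
  imports "HOL-Probability.Probability"
begin

definition l1_ball :: "(real ^ 'n) set" where
  "l1_ball = {f. (\<Sum>j\<in>UNIV. \<bar>f $ j\<bar>) \<le> 1}"

definition linf_ball :: "(real ^ 'n) set" where
  "linf_ball = {x. infnorm x \<le> 1}"

definition regret :: "nat \<Rightarrow> (nat \<Rightarrow> real ^ 'n) \<Rightarrow> (nat \<Rightarrow> real ^ 'n) \<Rightarrow> real" where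
  "regret T f x =
     (\<Sum>t=1..T. f t \<bullet> x t) - (INF g\<in>l1_ball. \<Sum>t=1..T. g \<bullet> x t)"

definition rademacher :: "real measure" where
  "rademacher = distr (measure_pmf (pmf_of_set {-1, 1})) borel (\<lambda>e. e)"

definition symmetric_distribution :: "real measure \<Rightarrow> bool" where
  "symmetric_distribution D \<longleftrightarrow> distr D borel uminus = D"

(* The N-fold product D^N, transported from functions on the index type to vectors. *)
definition iid_vector :: "real measure \<Rightarrow> (real ^ 'n) measure" where
  "iid_vector D = distr (Pi\<^sub>M UNIV (\<lambda>_. D)) borel (\<lambda>u. \<chi> j. u j)"

(* Joint law of independent signs and vectors, both indexed by I. *)
definition draw_law :: "real measure \<Rightarrow> nat set \<Rightarrow> ((nat \<Rightarrow> real) \<times> (nat \<Rightarrow> real ^ 'n)) measure" where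
  "draw_law D I = Pi\<^sub>M I (\<lambda>_. rademacher) \<Otimes>\<^sub>M Pi\<^sub>M I (\<lambda>_. iid_vector D)"

(* Y has law Q and is independent of the A-valued random variable X, expressed by saying
   that the joint law of (X, Y) is a product (indep_var would force X and Y to have the
   same type). *)
definition fresh_sample ::
  "'w measure \<Rightarrow> 'a measure \<Rightarrow> ('w \<Rightarrow> 'a) \<Rightarrow> 'b measure \<Rightarrow> ('w \<Rightarrow> 'b) \<Rightarrow> bool" where
  "fresh_sample M A X Q Y \<longleftrightarrow>
     X \<in> M \<rightarrow>\<^sub>M A \<and> Y \<in> M \<rightarrow>\<^sub>M Q \<and>
     distr M (A \<Otimes>\<^sub>M Q) (\<lambda>w. (X w, Y w)) = distr M A X \<Otimes>\<^sub>M Q"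

(* Everything that must not be correlated with the learner's randomness of round t: the
   moves of both players before round t, and Nature's move of round t, which is made
   simultaneously with the learner's. *)
definition moves_upto ::
  "nat \<Rightarrow> (nat \<Rightarrow> 'w \<Rightarrow> real ^ 'n) \<Rightarrow> (nat \<Rightarrow> 'w \<Rightarrow> real ^ 'n) \<Rightarrow>
   'w \<Rightarrow> (nat \<Rightarrow> (real ^ 'n) \<times> (real ^ 'n)) \<times> (real ^ 'n)" where
  "moves_upto t f x w = ((\<lambda>s\<in>{1..<t}. (f s w, x s w)), x t w)"

definition moves_space ::
  "nat \<Rightarrow> ((nat \<Rightarrow> (real ^ 'n) \<times> (real ^ 'n)) \<times> (real ^ 'n)) measure" where
  "moves_space t = Pi\<^sub>M {1..<t} (\<lambda>_. borel) \<Otimes>\<^sub>M borel"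

end

theory Submission
  imports Defs
begin

text \<open>
  The potential after round \<open>t\<close> is the expected \<open>\<infinity>\<close>-norm of the sum of Nature's first \<open>t\<close> moves minus
  \<open>C\<close> times a fresh draw of the remaining noise. It starts at \<open>C\<close> times the expected norm of
  the full noise and ends at the norm of the sum of all moves, which is the negative of the loss of the best
  fixed action. It suffices that in each round the loss plus the new potential is at
  most the old potential. This holds pointwise: if \<open>g\<close> minimizes \<open>g \<bullet> w\<close>, then
  \<open>g \<bullet> y + \<parallel>w + y\<parallel>\<^sub>\<infinity> \<le> E \<parallel>w - C \<epsilon> v\<parallel>\<^sub>\<infinity>\<close> for every move \<open>y\<close>. Freshness of the draws enters only when the noise of consecutive rounds is
  identified in law.
\<close>

section \<open>Duality between the two balls\<close>

lemma borel_measurable_infnorm [measurable]: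
  "(infnorm :: 'a::euclidean_space \<Rightarrow> real) \<in> borel_measurable borel"
  by (intro borel_measurable_continuous_onI continuous_on_infnorm continuous_on_id)

lemma infnorm_le_iff_cart: "infnorm (x :: real ^ 'n) \<le> a \<longleftrightarrow> (\<forall>i. \<bar>x $ i\<bar> \<le> a)"
  unfolding infnorm_Max by (subst Max_le_iff) (auto simp: Basis_vec_def inner_axis)

lemma infnorm_le_sum_cart: "infnorm (x :: real ^ 'n) \<le> (\<Sum>i\<in>UNIV. \<bar>x $ i\<bar>)"
  unfolding infnorm_le_iff_cart by (auto intro!: member_le_sum)

lemma inner_l1_ball_bound:
  assumes "g \<in> l1_ball"
  shows "\<bar>g \<bullet> (y :: real ^ 'n)\<bar> \<le> infnorm y"
proof -
  have "\<bar>g \<bullet> y\<bar> \<le> (\<Sum>i\<in>UNIV. \<bar>g $ i * y $ i\<bar>)"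
    by (simp add: inner_vec_def sum_abs)
  also have "\<dots> \<le> (\<Sum>i\<in>UNIV. \<bar>g $ i\<bar> * infnorm y)"
    by (intro sum_mono) (auto simp: abs_mult intro!: mult_left_mono component_le_infnorm_cart)
  also have "\<dots> = (\<Sum>i\<in>UNIV. \<bar>g $ i\<bar>) * infnorm y"
    by (simp add: sum_distrib_right)
  also have "\<dots> \<le> 1 * infnorm y"
    using assms by (intro mult_right_mono) (auto simp: l1_ball_def infnorm_pos_le)
  finally show ?thesis by simp
qed

lemma axis_in_l1_ball: "\<bar>a\<bar> \<le> 1 \<Longrightarrow> axis k a \<in> l1_ball"
  by (simp add: l1_ball_def axis_def if_distrib cong: if_cong)

text \<open>Duality bounds the total loss of every fixed action below by minus the norm of the
  summed moves. This turns the comparator term into the final potential.\<close>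

lemma regret_le:
  "regret T f x \<le> (\<Sum>t=1..T. f t \<bullet> x t) + infnorm (\<Sum>t=1..T. x t)"
proof -
  have "- infnorm (\<Sum>t=1..T. x t) \<le> (INF g\<in>l1_ball. \<Sum>t=1..T. g \<bullet> x t)"
  proof (rule cINF_greatest)
    show "l1_ball \<noteq> {}"
      using axis_in_l1_ball[of 0] by fastforce
    show "- infnorm (\<Sum>t=1..T. x t) \<le> (\<Sum>t=1..T. g \<bullet> x t)" if "g \<in> l1_ball" for g
      using inner_l1_ball_bound[OF that, of "\<Sum>t=1..T. x t"] by (simp add: inner_sum_right)
  qed
  then show ?thesis
    by (simp add: regret_def)
qed

text \<open>Comparing \<open>g\<close> with the signed vertex in direction \<open>k\<close> bounds
  \<open>g \<bullet> w\<close> by \<open>- \<bar>w $ k\<bar>\<close>. Hence the gaps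
  \<open>\<bar>w $ k\<bar> - \<bar>w $ i\<bar>\<close>, weighted by
  \<open>\<bar>g $ i\<bar>\<close>, sum to at most 0. Each term is nonnegative, so all vanish and
  \<open>g\<close> has no mass off \<open>k\<close>.\<close>

lemma l1_ball_argmin_unique_max:
  fixes w :: "real ^ 'n"
  assumes g: "is_arg_min (\<lambda>g. g \<bullet> w) (\<lambda>g. g \<in> l1_ball) g"
    and k: "\<And>i. i \<noteq> k \<Longrightarrow> \<bar>w $ i\<bar> < \<bar>w $ k\<bar>" and "w $ k \<noteq> 0"
  shows "g = axis k (- sgn (w $ k))"
proof -
  have g1: "(\<Sum>i\<in>UNIV. \<bar>g $ i\<bar>) \<le> 1"
    using g by (simp add: is_arg_min_linorder l1_ball_def)
  have "g \<bullet> w \<le> axis k (- sgn (w $ k)) \<bullet> w"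
    using g axis_in_l1_ball[of "- sgn (w $ k)" k]
    by (simp add: is_arg_min_linorder abs_sgn_eq)
  then have gw: "(\<Sum>i\<in>UNIV. g $ i * w $ i) \<le> - \<bar>w $ k\<bar>"
    by (simp add: inner_axis' inner_vec_def[of g] abs_sgn mult.commute)
  have "(\<Sum>i\<in>UNIV. \<bar>g $ i\<bar> * (\<bar>w $ k\<bar> - \<bar>w $ i\<bar>))
      = (\<Sum>i\<in>UNIV. \<bar>g $ i\<bar>) * \<bar>w $ k\<bar> - (\<Sum>i\<in>UNIV. \<bar>g $ i * w $ i\<bar>)"
    by (simp add: algebra_simps sum_subtractf sum_distrib_left abs_mult)
  also have "\<dots> \<le> 1 * \<bar>w $ k\<bar> - \<bar>w $ k\<bar>"
    using gw sum_abs[of "\<lambda>i. g $ i * w $ i" UNIV]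
    by (intro diff_mono mult_right_mono g1) auto
  finally have "(\<Sum>i\<in>UNIV. \<bar>g $ i\<bar> * (\<bar>w $ k\<bar> - \<bar>w $ i\<bar>)) \<le> 0"
    by simp
  moreover have nn: "\<bar>g $ i\<bar> * (\<bar>w $ k\<bar> - \<bar>w $ i\<bar>) \<ge> 0" for i
    using k[of i] by (cases "i = k") auto
  ultimately have z: "\<bar>g $ i\<bar> * (\<bar>w $ k\<bar> - \<bar>w $ i\<bar>) = 0" for i
    using sum_nonneg_eq_0_iff[of UNIV "\<lambda>i. \<bar>g $ i\<bar> * (\<bar>w $ k\<bar> - \<bar>w $ i\<bar>)"]
    by (simp add: order_antisym sum_nonneg)
  have g0: "g $ i = 0" if "i \<noteq> k" for i
    using z[of i] k[OF that] by auto
  have "g $ k * w $ k \<le> - \<bar>w $ k\<bar>"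
    using gw by (subst (asm) sum.remove[of _ k]) (auto simp: g0)
  moreover have "\<bar>g $ k\<bar> \<le> 1"
    using g1 by (subst (asm) sum.remove[of _ k]) (auto simp: g0)
  ultimately have "g $ k = - sgn (w $ k)"
    using \<open>w $ k \<noteq> 0\<close> mult_le_cancel_right[of "g $ k" "w $ k" "- sgn (w $ k)"]
    by (auto simp: sgn_if abs_le_iff split: if_splits)
  with g0 show ?thesis
    by (auto simp: vec_eq_iff axis_def)
qed

section \<open>Rademacher signs and fresh draws\<close>

lemma nn_integral_rademacher:
  assumes [measurable]: "h \<in> borel_measurable borel"
  shows "(\<integral>\<^sup>+e. h e \<partial>rademacher) = (h 1 + h (-1)) / 2"
  unfolding rademacher_def
  by (subst nn_integral_distr) (auto simp: nn_integral_pmf_of_set add.commute)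

lemma prob_space_rademacher: "prob_space rademacher"
  unfolding rademacher_def by (intro prob_space.prob_space_distr measure_pmf.prob_space_axioms) simp

lemma sets_rademacher [simp, measurable_cong]: "sets rademacher = sets borel"
  by (simp add: rademacher_def)

lemma sets_iid_vector [simp, measurable_cong]: "sets (iid_vector D) = sets borel"
  by (simp add: iid_vector_def)

text \<open>The joint law is a product, so Tonelli's theorem exchanges the actual draw for an
  independent integration over its law.\<close>

lemma fresh_sample_nn_integral:
  assumes "fresh_sample M A X Q Y" "sigma_finite_measure Q"
    and h [measurable]: "case_prod h \<in> borel_measurable (A \<Otimes>\<^sub>M Q)"
  shows "(\<integral>\<^sup>+w. h (X w) (Y w) \<partial>M) = (\<integral>\<^sup>+w. (\<integral>\<^sup>+q. h (X w) q \<partial>Q) \<partial>M)"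
proof -
  interpret Q: sigma_finite_measure Q by fact
  have [measurable]: "X \<in> M \<rightarrow>\<^sub>M A" "Y \<in> M \<rightarrow>\<^sub>M Q"
    and eq: "distr M (A \<Otimes>\<^sub>M Q) (\<lambda>w. (X w, Y w)) = distr M A X \<Otimes>\<^sub>M Q"
    using assms by (auto simp: fresh_sample_def)
  have "(\<integral>\<^sup>+w. h (X w) (Y w) \<partial>M) = integral\<^sup>N (distr M (A \<Otimes>\<^sub>M Q) (\<lambda>w. (X w, Y w))) (case_prod h)"
    by (subst nn_integral_distr) auto
  also have "\<dots> = (\<integral>\<^sup>+a. (\<integral>\<^sup>+q. h a q \<partial>Q) \<partial>distr M A X)"
    unfolding eq by (subst Q.nn_integral_fst[symmetric]) auto
  also have "\<dots> = (\<integral>\<^sup>+w. (\<integral>\<^sup>+q. h (X w) q \<partial>Q) \<partial>M)"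
    by (subst nn_integral_distr) auto
  finally show ?thesis .
qed

section \<open>Vectors with independent symmetric coordinates\<close>

context real_distribution
begin

lemma measurable_vec_lambda_PiM [measurable]:
  "(\<lambda>u. \<chi> j. u j) \<in> Pi\<^sub>M (UNIV :: 'n::finite set) (\<lambda>_. M) \<rightarrow>\<^sub>M (borel :: (real ^ 'n) measure)"
  by (subst borel_measurable_euclidean_space) (auto simp: Basis_vec_def inner_axis)

lemma prob_space_iid_vector: "prob_space (iid_vector M :: (real ^ 'n) measure)"
  unfolding iid_vector_def
  by (intro prob_space.prob_space_distr prob_space_PiM) (auto intro: prob_space_axioms)

text \<open>Independence of coordinates in usable form: coordinate \<open>k\<close> is integrated
  while the others stay frozen.\<close>

lemma nn_integral_iid_vector:
  fixes h :: "real ^ 'n \<Rightarrow> ennreal"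
  assumes [measurable]: "h \<in> borel_measurable borel"
  shows "(\<integral>\<^sup>+v. h v \<partial>iid_vector M)
    = (\<integral>\<^sup>+u. (\<integral>\<^sup>+b. h (\<chi> j. (u(k := b)) j) \<partial>M) \<partial>Pi\<^sub>M (UNIV - {k}) (\<lambda>_. M))"
proof -
  interpret product_sigma_finite "\<lambda>_. M" by standard
  have "(\<integral>\<^sup>+v. h v \<partial>iid_vector M) = (\<integral>\<^sup>+u. h (\<chi> j. u j) \<partial>Pi\<^sub>M (insert k (UNIV - {k})) (\<lambda>_. M))"
    unfolding iid_vector_def by (subst nn_integral_distr) (auto simp: insert_UNIV)
  also have "\<dots> = (\<integral>\<^sup>+u. (\<integral>\<^sup>+b. h (\<chi> j. (u(k := b)) j) \<partial>M) \<partial>Pi\<^sub>M (UNIV - {k}) (\<lambda>_. M))"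
    by (subst product_nn_integral_insert) (auto simp: insert_UNIV)
  finally show ?thesis .
qed

lemma nn_integral_iid_vector_component:
  assumes [measurable]: "h \<in> borel_measurable borel"
  shows "(\<integral>\<^sup>+v. h (v $ k) \<partial>(iid_vector M :: (real ^ 'n) measure)) = (\<integral>\<^sup>+b. h b \<partial>M)"
proof -
  interpret P: prob_space "Pi\<^sub>M (UNIV - {k}) (\<lambda>_. M)"
    by (intro prob_space_PiM prob_space_axioms)
  show ?thesis
    by (subst nn_integral_iid_vector[where k = k]) (auto simp: P.emeasure_space_1)
qed

text \<open>By symmetry \<open>b\<close> and \<open>- b\<close> have the same law, and the triangle
  inequality bounds \<open>2 * \<bar>a\<bar>\<close> by the sum of the two shifted absolute
  values.\<close>

lemma nn_integral_symmetric_shift: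
  assumes sym: "symmetric_distribution M"
  shows "ennreal \<bar>a\<bar> \<le> (\<integral>\<^sup>+b. ennreal \<bar>a + s * b\<bar> \<partial>M)"
proof -
  have "(\<integral>\<^sup>+b. ennreal \<bar>a + s * b\<bar> \<partial>M) = (\<integral>\<^sup>+b. ennreal \<bar>a + s * b\<bar> \<partial>distr M borel uminus)"
    using sym by (simp add: symmetric_distribution_def)
  also have "\<dots> = (\<integral>\<^sup>+b. ennreal \<bar>a - s * b\<bar> \<partial>M)"
    by (subst nn_integral_distr) auto
  finally have "2 * (\<integral>\<^sup>+b. ennreal \<bar>a + s * b\<bar> \<partial>M)
      = (\<integral>\<^sup>+b. ennreal \<bar>a + s * b\<bar> + ennreal \<bar>a - s * b\<bar> \<partial>M)"
    by (subst nn_integral_add) (auto simp: mult_2)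
  moreover have "(\<integral>\<^sup>+b. 2 * ennreal \<bar>a\<bar> \<partial>M)
      \<le> (\<integral>\<^sup>+b. ennreal \<bar>a + s * b\<bar> + ennreal \<bar>a - s * b\<bar> \<partial>M)"
    by (intro nn_integral_mono)
       (auto simp: ennreal_plus[symmetric] ennreal_mult[symmetric] ennreal_numeral[symmetric]
             simp del: ennreal_plus ennreal_numeral intro!: ennreal_leI)
  ultimately have "2 * ennreal \<bar>a\<bar> \<le> 2 * (\<integral>\<^sup>+b. ennreal \<bar>a + s * b\<bar> \<partial>M)"
    by (simp add: emeasure_space_1[simplified])
  then show ?thesis
    by (subst (asm) ennreal_mult_le_mult_iff) auto
qed

text \<open>With \<open>v $ i\<close> frozen, the independent term in \<open>v $ k\<close> is a
  symmetric shift and cannot lower the mean absolute value.\<close>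

lemma nn_integral_iid_vector_pair:
  assumes sym: "symmetric_distribution M" and "i \<noteq> k"
  shows "(\<integral>\<^sup>+b. ennreal \<bar>r * b\<bar> \<partial>M)
    \<le> (\<integral>\<^sup>+v. ennreal \<bar>r * v $ i - s * v $ k\<bar> \<partial>(iid_vector M :: (real ^ 'n) measure))"
proof -
  have "(\<integral>\<^sup>+b. ennreal \<bar>r * b\<bar> \<partial>M)
      = (\<integral>\<^sup>+v. ennreal \<bar>r * v $ i\<bar> \<partial>(iid_vector M :: (real ^ 'n) measure))"
    by (subst nn_integral_iid_vector_component[where k = i]) auto
  also have "\<dots> \<le> (\<integral>\<^sup>+v. ennreal \<bar>r * v $ i - s * v $ k\<bar> \<partial>(iid_vector M :: (real ^ 'n) measure))"
    using \<open>i \<noteq> k\<close> nn_integral_symmetric_shift[OF sym, of _ "- s"]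
    by (subst (1 2) nn_integral_iid_vector[where k = k])
       (auto intro!: nn_integral_mono simp: emeasure_space_1[simplified])
  finally show ?thesis .
qed

end

section \<open>One round of perturbation and the accumulated noise\<close>

text \<open>Averages over the noise of a single round. Values in \<open>ennreal\<close> make it
  meaningful before integrability is known.\<close>

definition perturbed_norm :: "real measure \<Rightarrow> real \<Rightarrow> real ^ 'n \<Rightarrow> ennreal" where
  "perturbed_norm D C w =
    (\<integral>\<^sup>+e. (\<integral>\<^sup>+v. ennreal (infnorm (w - C *\<^sub>R (e *\<^sub>R v))) \<partial>iid_vector D) \<partial>rademacher)"

definition noise :: "nat set \<Rightarrow> (nat \<Rightarrow> real) \<times> (nat \<Rightarrow> real ^ 'n) \<Rightarrow> real ^ 'n" where
  "noise I p = (\<Sum>i\<in>I. fst p i *\<^sub>R snd p i)"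

lemma noise_insert:
  assumes "finite I" "i \<notin> I"
  shows "noise (insert i I) (E(i := e), V(i := v)) = noise I (E, V) + e *\<^sub>R v"
proof -
  have "(E(i := e)) j *\<^sub>R (V(i := v)) j = E j *\<^sub>R V j" if "j \<in> I" for j
    using that assms(2) by (cases "j = i") auto
  then have "(\<Sum>j\<in>I. (E(i := e)) j *\<^sub>R (V(i := v)) j) = (\<Sum>j\<in>I. E j *\<^sub>R V j)"
    by (intro sum.cong refl)
  then show ?thesis
    using assms by (simp add: noise_def add.commute)
qed

lemma noise_measurable_Pair [measurable (raw)]:
  fixes V :: "'a \<Rightarrow> nat \<Rightarrow> real ^ 'n"
  assumes [measurable]: "E \<in> N \<rightarrow>\<^sub>M Pi\<^sub>M I (\<lambda>_. rademacher)" "V \<in> N \<rightarrow>\<^sub>M Pi\<^sub>M I (\<lambda>_. iid_vector D)"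
  shows "(\<lambda>x. noise I (E x, V x)) \<in> borel_measurable N"
proof -
  have [measurable]: "(\<lambda>x. E x i) \<in> borel_measurable N" "(\<lambda>x. V x i) \<in> borel_measurable N" if "i \<in> I" for i
    using measurable_compose[OF assms(1) measurable_component_singleton[OF that]]
      measurable_compose[OF assms(2) measurable_component_singleton[OF that]]
    by (simp_all cong: measurable_cong_sets)
  show ?thesis
    unfolding noise_def fst_conv snd_conv by (intro borel_measurable_sum) simp
qed

lemma noise_measurable [measurable]:
  "noise I \<in> draw_law D I \<rightarrow>\<^sub>M (borel :: (real ^ 'n) measure)"
  unfolding draw_law_def
  using noise_measurable_Pair[OF measurable_fst measurable_snd] by simp

section \<open>Peeling one index off the noise\<close>

context real_distribution
begin

lemma prob_space_draw_law: "prob_space (draw_law M I)"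
  unfolding draw_law_def
  by (intro prob_space_pair prob_space_PiM prob_space_rademacher prob_space_iid_vector)

text \<open>\<open>draw_law\<close> keeps all signs in one product and all vectors in another.
  Splitting index \<open>i\<close> off both leaves its sign outside the integral over the other
  vectors; Tonelli's theorem moves it inside.\<close>

lemma nn_integral_draw_law_insert:
  fixes h :: "real ^ 'n \<Rightarrow> ennreal"
  assumes [measurable]: "h \<in> borel_measurable borel" and I: "finite I" "i \<notin> I"
  shows "(\<integral>\<^sup>+p. h (noise (insert i I) p) \<partial>draw_law M (insert i I))
    = (\<integral>\<^sup>+p. (\<integral>\<^sup>+e. (\<integral>\<^sup>+v. h (noise I p + e *\<^sub>R v) \<partial>iid_vector M) \<partial>rademacher) \<partial>draw_law M I)"
proof -
  interpret R: prob_space rademacher by (rule prob_space_rademacher)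
  interpret V: prob_space "iid_vector M :: (real ^ 'n) measure" by (rule prob_space_iid_vector)
  interpret PR: product_sigma_finite "\<lambda>_::nat. rademacher" by standard
  interpret PV: product_sigma_finite "\<lambda>_::nat. iid_vector M :: (real ^ 'n) measure" by standard
  interpret PVI: prob_space "Pi\<^sub>M J (\<lambda>_. iid_vector M :: (real ^ 'n) measure)" for J :: "nat set"
    by (intro prob_space_PiM prob_space_iid_vector)
  have upd: "noise (insert i I) (E(i := e), V(i := v)) = noise I (E, V) + e *\<^sub>R v"
    for E e and V :: "nat \<Rightarrow> real ^ 'n" and v
    using I by (rule noise_insert)
  have swap: "(\<integral>\<^sup>+e. (\<integral>\<^sup>+V. (\<integral>\<^sup>+v. h (noise I (E, V) + e *\<^sub>R v) \<partial>iid_vector M)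
        \<partial>Pi\<^sub>M I (\<lambda>_. iid_vector M)) \<partial>rademacher)
      = (\<integral>\<^sup>+V. (\<integral>\<^sup>+e. (\<integral>\<^sup>+v. h (noise I (E, V) + e *\<^sub>R v) \<partial>iid_vector M) \<partial>rademacher)
        \<partial>Pi\<^sub>M I (\<lambda>_. iid_vector M))" if "E \<in> space (Pi\<^sub>M I (\<lambda>_. rademacher))" for E
  proof -
    interpret pair_sigma_finite "Pi\<^sub>M I (\<lambda>_. iid_vector M :: (real ^ 'n) measure)" rademacher
      by standard
    have [measurable]: "(\<lambda>_. E) \<in> N \<rightarrow>\<^sub>M Pi\<^sub>M I (\<lambda>_. rademacher)" for N :: "'c measure"
      using that by simp
    show ?thesis by (rule Fubini') measurable
  qed
  have "(\<integral>\<^sup>+p. h (noise (insert i I) p) \<partial>draw_law M (insert i I))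
    = (\<integral>\<^sup>+E. (\<integral>\<^sup>+V. h (noise (insert i I) (E, V)) \<partial>Pi\<^sub>M (insert i I) (\<lambda>_. iid_vector M))
        \<partial>Pi\<^sub>M (insert i I) (\<lambda>_. rademacher))"
    unfolding draw_law_def
    by (subst PVI.nn_integral_fst[symmetric]) (auto simp flip: draw_law_def)
  also have "\<dots> = (\<integral>\<^sup>+E. (\<integral>\<^sup>+e. (\<integral>\<^sup>+V. h (noise (insert i I) (E(i := e), V))
        \<partial>Pi\<^sub>M (insert i I) (\<lambda>_. iid_vector M)) \<partial>rademacher) \<partial>Pi\<^sub>M I (\<lambda>_. rademacher))"
    by (subst PR.product_nn_integral_insert[OF I]) simp_all
  also have "\<dots> = (\<integral>\<^sup>+E. (\<integral>\<^sup>+e. (\<integral>\<^sup>+V. (\<integral>\<^sup>+v. h (noise I (E, V) + e *\<^sub>R v) \<partial>iid_vector M)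
        \<partial>Pi\<^sub>M I (\<lambda>_. iid_vector M)) \<partial>rademacher) \<partial>Pi\<^sub>M I (\<lambda>_. rademacher))"
  proof (intro nn_integral_cong)
    fix E e assume "E \<in> space (Pi\<^sub>M I (\<lambda>_. rademacher))" and "e \<in> space rademacher"
    then have "E(i := e) \<in> space (Pi\<^sub>M (insert i I) (\<lambda>_. rademacher))"
      by (auto simp: space_PiM intro!: PiE_fun_upd)
    then have "(\<lambda>_. E(i := e)) \<in> Pi\<^sub>M (insert i I) (\<lambda>_. iid_vector M :: (real ^ 'n) measure)
        \<rightarrow>\<^sub>M Pi\<^sub>M (insert i I) (\<lambda>_. rademacher)"
      by simp
    then have [measurable]: "(\<lambda>V. noise (insert i I) (E(i := e), V))
        \<in> Pi\<^sub>M (insert i I) (\<lambda>_. iid_vector M) \<rightarrow>\<^sub>M (borel :: (real ^ 'n) measure)"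
      by (rule noise_measurable_Pair[where D = M]) simp
    show "(\<integral>\<^sup>+V. h (noise (insert i I) (E(i := e), V)) \<partial>Pi\<^sub>M (insert i I) (\<lambda>_. iid_vector M))
      = (\<integral>\<^sup>+V. (\<integral>\<^sup>+v. h (noise I (E, V) + e *\<^sub>R v) \<partial>iid_vector M) \<partial>Pi\<^sub>M I (\<lambda>_. iid_vector M))"
      by (subst PV.product_nn_integral_insert[OF I]) (simp_all add: upd)
  qed
  also have "\<dots> = (\<integral>\<^sup>+E. (\<integral>\<^sup>+V. (\<integral>\<^sup>+e. (\<integral>\<^sup>+v. h (noise I (E, V) + e *\<^sub>R v) \<partial>iid_vector M) \<partial>rademacher)
        \<partial>Pi\<^sub>M I (\<lambda>_. iid_vector M)) \<partial>Pi\<^sub>M I (\<lambda>_. rademacher))"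
    by (intro nn_integral_cong swap)
  also have "\<dots> = (\<integral>\<^sup>+p. (\<integral>\<^sup>+e. (\<integral>\<^sup>+v. h (noise I p + e *\<^sub>R v) \<partial>iid_vector M) \<partial>rademacher) \<partial>draw_law M I)"
    unfolding draw_law_def
    by (subst PVI.nn_integral_fst[symmetric]) (auto simp flip: draw_law_def)
  finally show ?thesis .
qed

section \<open>Lower bounds for the perturbed norm\<close>

lemma perturbed_norm_eq:
  "perturbed_norm M C (w :: real ^ 'n)
    = (\<integral>\<^sup>+v. ennreal ((infnorm (w - C *\<^sub>R v) + infnorm (w + C *\<^sub>R v)) / 2) \<partial>iid_vector M)"
proof -
  interpret V: prob_space "iid_vector M :: (real ^ 'n) measure" by (rule prob_space_iid_vector)
  have "perturbed_norm M C w = ((\<integral>\<^sup>+v. ennreal (infnorm (w - C *\<^sub>R v)) \<partial>iid_vector M)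
      + (\<integral>\<^sup>+v. ennreal (infnorm (w + C *\<^sub>R v)) \<partial>iid_vector M)) / 2"
    unfolding perturbed_norm_def by (subst nn_integral_rademacher) simp_all
  also have "\<dots> = (\<integral>\<^sup>+v. (ennreal (infnorm (w - C *\<^sub>R v)) + ennreal (infnorm (w + C *\<^sub>R v))) / 2 \<partial>iid_vector M)"
    by (simp add: nn_integral_add nn_integral_divide)
  also have "\<dots> = (\<integral>\<^sup>+v. ennreal ((infnorm (w - C *\<^sub>R v) + infnorm (w + C *\<^sub>R v)) / 2) \<partial>iid_vector M)"
    by (intro nn_integral_cong)
       (simp add: infnorm_pos_le ennreal_plus[symmetric] divide_ennreal[symmetric] del: ennreal_plus)
  finally show ?thesis .
qed

text \<open>Convexity: \<open>w\<close> is the midpoint of its two perturbations.\<close>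

lemma abs_component_le_perturbed_norm: "ennreal \<bar>w $ k\<bar> \<le> perturbed_norm M C (w :: real ^ 'n)"
proof -
  interpret V: prob_space "iid_vector M :: (real ^ 'n) measure" by (rule prob_space_iid_vector)
  have "\<bar>w $ k\<bar> \<le> (infnorm (w - C *\<^sub>R v) + infnorm (w + C *\<^sub>R v)) / 2" for v
    using component_le_infnorm_cart[of "w - C *\<^sub>R v" k] component_le_infnorm_cart[of "w + C *\<^sub>R v" k]
    by simp
  then have "(\<integral>\<^sup>+v. ennreal \<bar>w $ k\<bar> \<partial>(iid_vector M :: (real ^ 'n) measure)) \<le> perturbed_norm M C w"
    unfolding perturbed_norm_eq by (intro nn_integral_mono ennreal_leI)
  then show ?thesis by (simp add: V.emeasure_space_1)
qed

lemma nn_integral_abs_scaled: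
  assumes "integrable M (\<lambda>u. \<bar>u\<bar>)"
  shows "(\<integral>\<^sup>+b. ennreal \<bar>r * b\<bar> \<partial>M) = ennreal (\<bar>r\<bar> * (\<integral>u. \<bar>u\<bar> \<partial>M))"
  using assms by (subst nn_integral_eq_integral) (auto simp: abs_mult)

text \<open>Half the difference of the two perturbed vectors is the perturbation itself, so any one
  of its coordinates is dominated by the averaged norm, however small \<open>w\<close> is.\<close>

lemma moment_le_perturbed_norm:
  assumes "integrable M (\<lambda>u. \<bar>u\<bar>)"
  shows "ennreal (\<bar>C\<bar> * (\<integral>u. \<bar>u\<bar> \<partial>M)) \<le> perturbed_norm M C (w :: real ^ 'n)"
proof -
  fix k :: 'n
  have "\<bar>C * v $ k\<bar> \<le> (infnorm (w - C *\<^sub>R v) + infnorm (w + C *\<^sub>R v)) / 2" for v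
    using component_le_infnorm_cart[of "w - C *\<^sub>R v" k] component_le_infnorm_cart[of "w + C *\<^sub>R v" k]
    by simp
  then have "(\<integral>\<^sup>+v. ennreal \<bar>C * v $ k\<bar> \<partial>iid_vector M) \<le> perturbed_norm M C w"
    unfolding perturbed_norm_eq by (intro nn_integral_mono ennreal_leI)
  then show ?thesis
    by (simp add: nn_integral_iid_vector_component[where h = "\<lambda>b. ennreal \<bar>C * b\<bar>"]
        nn_integral_abs_scaled[OF assms])
qed

text \<open>The two signs of the Rademacher variable lift whichever of the coordinates \<open>i\<close>, \<open>k\<close> has the larger signed
  perturbation, which gains half of their difference on average.\<close>

lemma second_component_le_perturbed_norm:
  fixes w :: "real ^ 'n"
  assumes sym: "symmetric_distribution M" and int: "integrable M (\<lambda>u. \<bar>u\<bar>)"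
    and ik: "i \<noteq> k" "\<bar>w $ k\<bar> \<le> \<bar>w $ i\<bar>"
  shows "ennreal (\<bar>w $ k\<bar> + \<bar>C\<bar> * (\<integral>u. \<bar>u\<bar> \<partial>M) / 2) \<le> perturbed_norm M C w"
proof -
  interpret V: prob_space "iid_vector M :: (real ^ 'n) measure" by (rule prob_space_iid_vector)
  \<comment> \<open>Unlike \<open>sgn\<close>, this is never 0: a zero coordinate also needs an
    orientation, since \<open>\<bar>s i\<bar> = 1\<close> enters the moment below.\<close>
  define s where "s j = (if 0 \<le> w $ j then 1 else -1 :: real)" for j
  have le: "\<bar>w $ k\<bar> + \<bar>C / 2 * s i * v $ i - C / 2 * s k * v $ k\<bar>
      \<le> (infnorm (w - C *\<^sub>R v) + infnorm (w + C *\<^sub>R v)) / 2" for v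
  proof -
    have "\<bar>w $ j\<bar> + C * s j * v $ j \<le> infnorm (w + C *\<^sub>R v)"
      "\<bar>w $ j\<bar> - C * s j * v $ j \<le> infnorm (w - C *\<^sub>R v)" for j
      using component_le_infnorm_cart[of "w - C *\<^sub>R v" j] component_le_infnorm_cart[of "w + C *\<^sub>R v" j]
      by (auto simp: s_def abs_le_iff)
    \<comment> \<open>Coordinate \<open>i\<close> is used for one sign of the perturbation and
      \<open>k\<close> for the other; the two pairings give the two signs of the absolute
      value.\<close>
    from this[of i] this[of k] ik(2) show ?thesis
      by (simp add: abs_if)
  qed
  have "ennreal (\<bar>w $ k\<bar> + \<bar>C\<bar> * (\<integral>u. \<bar>u\<bar> \<partial>M) / 2)
      = ennreal \<bar>w $ k\<bar> + (\<integral>\<^sup>+b. ennreal \<bar>C / 2 * s i * b\<bar> \<partial>M)"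
    by (subst nn_integral_abs_scaled[OF int])
       (auto simp: s_def abs_mult ennreal_plus[symmetric] simp del: ennreal_plus)
  also have "\<dots> \<le> ennreal \<bar>w $ k\<bar>
      + (\<integral>\<^sup>+v. ennreal \<bar>C / 2 * s i * v $ i - C / 2 * s k * v $ k\<bar> \<partial>iid_vector M)"
    by (intro add_left_mono nn_integral_iid_vector_pair sym ik)
  also have "\<dots> = (\<integral>\<^sup>+v. ennreal \<bar>w $ k\<bar> + ennreal \<bar>C / 2 * s i * v $ i - C / 2 * s k * v $ k\<bar> \<partial>iid_vector M)"
    by (subst nn_integral_add) (auto simp: V.emeasure_space_1)
  also have "\<dots> \<le> perturbed_norm M C w"
    unfolding perturbed_norm_eq using le
    by (intro nn_integral_mono) (auto simp: ennreal_plus[symmetric] simp del: ennreal_plus intro!: ennreal_leI)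
  finally show ?thesis .
qed

section \<open>The one-round inequality\<close>

text \<open>The threshold 4 comes from near ties: half of it must cover a loss of at most 1 plus a
  coordinate growth of at most 1. The bound is proved for each coordinate, and the norm is attained
  at one of them.\<close>

lemma follow_perturbed_leader_step:
  fixes w :: "real ^ 'n"
  assumes sym: "symmetric_distribution M" and int: "integrable M (\<lambda>u. \<bar>u\<bar>)"
    and C: "4 \<le> \<bar>C\<bar> * (\<integral>u. \<bar>u\<bar> \<partial>M)"
    and g: "is_arg_min (\<lambda>g. g \<bullet> w) (\<lambda>g. g \<in> l1_ball) g" and y: "y \<in> linf_ball"
  shows "ennreal (g \<bullet> y + infnorm (w + y)) \<le> perturbed_norm M C w"
proof -
  have y1: "\<bar>y $ i\<bar> \<le> 1" for i
    using y by (simp add: linf_ball_def infnorm_le_iff_cart)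
  have "\<bar>g \<bullet> y\<bar> \<le> infnorm y"
    using g by (intro inner_l1_ball_bound) (simp add: is_arg_min_linorder)
  then have gy: "g \<bullet> y \<le> 1"
    using y by (simp add: linf_ball_def)
  txt \<open>If another coordinate is at least as large as the \<open>k\<close>-th, the perturbation gains at least 2,
    more than any move costs. Otherwise the minimizer is a signed unit vector in direction \<open>k\<close>, and
    its loss offsets the growth of that coordinate, except that \<open>w $ k\<close> may change sign.\<close>
  have comp: "ennreal (g \<bullet> y + \<bar>w $ k + y $ k\<bar>) \<le> perturbed_norm M C w" for k
  proof (cases "\<exists>i. i \<noteq> k \<and> \<bar>w $ k\<bar> \<le> \<bar>w $ i\<bar>")
    case True
    then obtain i where i: "i \<noteq> k" "\<bar>w $ k\<bar> \<le> \<bar>w $ i\<bar>" by blast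
    have "ennreal (g \<bullet> y + \<bar>w $ k + y $ k\<bar>) \<le> ennreal (\<bar>w $ k\<bar> + \<bar>C\<bar> * (\<integral>u. \<bar>u\<bar> \<partial>M) / 2)"
      using gy C y1[of k] by (intro ennreal_leI) linarith
    also have "\<dots> \<le> perturbed_norm M C w"
      by (rule second_component_le_perturbed_norm[OF sym int i])
    finally show ?thesis .
  next
    case False
    then have less: "\<bar>w $ i\<bar> < \<bar>w $ k\<bar>" if "i \<noteq> k" for i
      using that by (auto simp: not_le)
    \<comment> \<open>Without a sign change the loss cancels the growth exactly. After one, the
      value is \<open>2 * \<bar>y $ k\<bar> - \<bar>w $ k\<bar>\<close>, at most 2. The case
      \<open>w $ k = 0\<close> can arise only in dimension one, where both terms are at most
      1.\<close>
    have "g \<bullet> y + \<bar>w $ k + y $ k\<bar> \<le> max \<bar>w $ k\<bar> 2"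
    proof (cases "w $ k = 0")
      case True
      then show ?thesis using gy y1[of k] by auto
    next
      case False
      then have "g \<bullet> y = - sgn (w $ k) * y $ k"
        using l1_ball_argmin_unique_max[OF g less] by (simp add: inner_axis')
      then have "w $ k > 0 \<and> g \<bullet> y = - y $ k \<or> w $ k < 0 \<and> g \<bullet> y = y $ k"
        using False by (cases "w $ k > 0") auto
      then show ?thesis
        using y1[of k] by linarith
    qed
    then consider "g \<bullet> y + \<bar>w $ k + y $ k\<bar> \<le> \<bar>w $ k\<bar>"
      | "g \<bullet> y + \<bar>w $ k + y $ k\<bar> \<le> \<bar>C\<bar> * (\<integral>u. \<bar>u\<bar> \<partial>M)"
      using C by linarith
    then show ?thesis
    proof cases
      case 1
      then show ?thesis
        by (rule order_trans[OF ennreal_leI abs_component_le_perturbed_norm])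
    next
      case 2
      then show ?thesis
        by (rule order_trans[OF ennreal_leI moment_le_perturbed_norm[OF int]])
    qed
  qed
  obtain k where "infnorm (w + y) = \<bar>(w + y) $ k\<bar>"
  proof -
    have "infnorm (w + y) \<in> (\<lambda>i. \<bar>(w + y) \<bullet> i\<bar>) ` Basis"
      unfolding infnorm_Max by (intro Max_in) auto
    then show ?thesis
      using that by (auto simp: Basis_vec_def inner_axis)
  qed
  with comp[of k] show ?thesis by simp
qed

section \<open>Integrating out one round and finiteness of the noise\<close>

lemma perturbed_norm_measurable [measurable]:
  "perturbed_norm M C \<in> borel_measurable (borel :: (real ^ 'n) measure)"
proof -
  interpret V: prob_space "iid_vector M :: (real ^ 'n) measure" by (rule prob_space_iid_vector)
  show ?thesis
    unfolding perturbed_norm_eq by measurable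
qed

text \<open>Expresses the potential before a round through the shorter noise that the potential
  after it uses, so that both can be compared under one draw.\<close>

lemma nn_integral_draw_law_perturbed_norm:
  fixes s :: "real ^ 'n"
  assumes "finite I" "i \<notin> I"
  shows "(\<integral>\<^sup>+p. ennreal (infnorm (s - C *\<^sub>R noise (insert i I) p)) \<partial>draw_law M (insert i I))
    = (\<integral>\<^sup>+p. perturbed_norm M C (s - C *\<^sub>R noise I p) \<partial>draw_law M I)"
  unfolding perturbed_norm_def
  by (subst nn_integral_draw_law_insert[OF _ assms]) (simp_all add: scaleR_add_right diff_diff_eq)

text \<open>A crude bound through the sum of coordinates, serving only to show finiteness.\<close>

lemma perturbed_norm_le:
  fixes w :: "real ^ 'n"
  assumes "integrable M (\<lambda>u. \<bar>u\<bar>)"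
  shows "perturbed_norm M C w
    \<le> ennreal (infnorm w + real CARD('n) * (\<bar>C\<bar> * (\<integral>u. \<bar>u\<bar> \<partial>M)))"
proof -
  interpret V: prob_space "iid_vector M :: (real ^ 'n) measure" by (rule prob_space_iid_vector)
  have "(infnorm (w - C *\<^sub>R v) + infnorm (w + C *\<^sub>R v)) / 2 \<le> infnorm w + (\<Sum>k\<in>UNIV. \<bar>C * v $ k\<bar>)" for v
    using infnorm_triangle[of w "C *\<^sub>R v"] infnorm_triangle[of w "- (C *\<^sub>R v)"]
      infnorm_le_sum_cart[of "C *\<^sub>R v"] by (simp add: infnorm_neg)
  then have "perturbed_norm M C w
      \<le> (\<integral>\<^sup>+v. ennreal (infnorm w + (\<Sum>k\<in>UNIV. \<bar>C * v $ k\<bar>)) \<partial>(iid_vector M :: (real ^ 'n) measure))"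
    unfolding perturbed_norm_eq by (intro nn_integral_mono ennreal_leI)
  also have "\<dots> = (\<integral>\<^sup>+v. ennreal (infnorm w) + (\<Sum>k\<in>UNIV. ennreal \<bar>C * v $ k\<bar>)
      \<partial>(iid_vector M :: (real ^ 'n) measure))"
    by (simp add: infnorm_pos_le sum_nonneg)
  also have "\<dots> = ennreal (infnorm w) + (\<Sum>k\<in>(UNIV :: 'n set). \<integral>\<^sup>+b. ennreal \<bar>C * b\<bar> \<partial>M)"
    by (simp add: nn_integral_add nn_integral_sum V.emeasure_space_1
        nn_integral_iid_vector_component[where h = "\<lambda>b. ennreal \<bar>C * b\<bar>"] del: sum_ennreal)
  also have "\<dots> = ennreal (infnorm w + real CARD('n) * (\<bar>C\<bar> * (\<integral>u. \<bar>u\<bar> \<partial>M)))"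
    by (simp add: nn_integral_abs_scaled[OF assms] infnorm_pos_le ennreal_of_nat_eq_real_of_nat
        ennreal_mult[symmetric])
  finally show ?thesis .
qed

lemma nn_integral_noise_finite:
  assumes "integrable M (\<lambda>u. \<bar>u\<bar>)" "finite I"
  shows "(\<integral>\<^sup>+p. ennreal (infnorm (noise I p :: real ^ 'n)) \<partial>draw_law M I) < \<infinity>"
  using \<open>finite I\<close>
proof induction
  case empty
  then show ?case by (simp add: noise_def infnorm_0)
next
  case (insert i I)
  interpret P: prob_space "draw_law M I :: ((nat \<Rightarrow> real) \<times> (nat \<Rightarrow> real ^ 'n)) measure"
    by (rule prob_space_draw_law)
  have "(\<integral>\<^sup>+p. ennreal (infnorm (noise (insert i I) p :: real ^ 'n)) \<partial>draw_law M (insert i I))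
      = (\<integral>\<^sup>+p. perturbed_norm M 1 (- noise I p :: real ^ 'n) \<partial>draw_law M I)"
    using nn_integral_draw_law_perturbed_norm[OF insert.hyps, of 0 1] by (simp add: infnorm_neg)
  also have "\<dots> \<le> (\<integral>\<^sup>+p. ennreal (infnorm (noise I p :: real ^ 'n))
      + ennreal (real CARD('n) * (\<integral>u. \<bar>u\<bar> \<partial>M)) \<partial>draw_law M I)"
    by (intro nn_integral_mono order_trans[OF perturbed_norm_le[OF assms(1)]]) (simp add: infnorm_neg infnorm_pos_le flip: ennreal_plus)
  also have "\<dots> < \<infinity>"
    using insert.IH by (simp add: nn_integral_add P.emeasure_space_1 ennreal_add_less_top)
  finally show ?case .
qed

text \<open>Passes from the extended integral to the iterated real integrals of the regret bound,
  with the vectors outermost.\<close>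

lemma nn_integral_noise:
  assumes "integrable M (\<lambda>u. \<bar>u\<bar>)" "finite I"
  shows "(\<integral>\<^sup>+p. ennreal (infnorm (noise I p :: real ^ 'n)) \<partial>draw_law M I)
    = ennreal (\<integral>v. (\<integral>e. infnorm (\<Sum>i\<in>I. e i *\<^sub>R v i) \<partial>Pi\<^sub>M I (\<lambda>_. rademacher))
        \<partial>Pi\<^sub>M I (\<lambda>_. iid_vector M :: (real ^ 'n) measure))"
proof -
  interpret R: prob_space "Pi\<^sub>M I (\<lambda>_. rademacher)"
    by (intro prob_space_PiM prob_space_rademacher)
  interpret V: prob_space "Pi\<^sub>M I (\<lambda>_. iid_vector M :: (real ^ 'n) measure)"
    by (intro prob_space_PiM prob_space_iid_vector)
  interpret pair_sigma_finite "Pi\<^sub>M I (\<lambda>_. rademacher)" "Pi\<^sub>M I (\<lambda>_. iid_vector M :: (real ^ 'n) measure)"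
    by standard
  have int: "integrable (draw_law M I) (\<lambda>p. infnorm (noise I p :: real ^ 'n))"
    using nn_integral_noise_finite[OF assms] by (intro integrableI_nonneg) (auto simp: infnorm_pos_le)
  then have "(\<integral>\<^sup>+p. ennreal (infnorm (noise I p :: real ^ 'n)) \<partial>draw_law M I)
      = ennreal (\<integral>p. infnorm (noise I p :: real ^ 'n) \<partial>draw_law M I)"
    by (intro nn_integral_eq_integral) (auto simp: infnorm_pos_le)
  also have "(\<integral>p. infnorm (noise I p :: real ^ 'n) \<partial>draw_law M I)
    = (\<integral>v. (\<integral>e. infnorm (\<Sum>i\<in>I. e i *\<^sub>R v i) \<partial>Pi\<^sub>M I (\<lambda>_. rademacher))
        \<partial>Pi\<^sub>M I (\<lambda>_. iid_vector M :: (real ^ 'n) measure))"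
    using integral_snd[of "\<lambda>e v. infnorm (noise I (e, v))"] int
    by (simp add: draw_law_def noise_def case_prod_beta')
  finally show ?thesis .
qed

end

section \<open>The potential argument\<close>

theorem lemma14:
  fixes M :: "'w measure"
    and D :: "real measure"
    and T :: nat
    and C :: real
    and x f :: "nat \<Rightarrow> 'w \<Rightarrow> real ^ 'n"
    and eps :: "nat \<Rightarrow> nat \<Rightarrow> 'w \<Rightarrow> real"
    and z :: "nat \<Rightarrow> nat \<Rightarrow> 'w \<Rightarrow> real ^ 'n"
  assumes D: "real_distribution D" "symmetric_distribution D"
    and D_moment: "integrable D (\<lambda>u. \<bar>u\<bar>)" "0 < (\<integral>u. \<bar>u\<bar> \<partial>D)"
    and C: "C = 6 / (\<integral>u. \<bar>u\<bar> \<partial>D)"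
    and M: "prob_space M"
    and nature: "\<And>t. t \<in> {1..T} \<Longrightarrow> x t \<in> borel_measurable M"
      "\<And>t w. t \<in> {1..T} \<Longrightarrow> w \<in> space M \<Longrightarrow> x t w \<in> linf_ball"
    and fresh: "\<And>t. t \<in> {1..T} \<Longrightarrow>
      fresh_sample M (moves_space t) (moves_upto t f x)
        (draw_law D {t+1..T}) (\<lambda>w. (\<lambda>i\<in>{t+1..T}. eps t i w, \<lambda>i\<in>{t+1..T}. z t i w))"
    and learner: "\<And>t. t \<in> {1..T} \<Longrightarrow> f t \<in> borel_measurable M"
      "\<And>t w. t \<in> {1..T} \<Longrightarrow> w \<in> space M \<Longrightarrow>
        is_arg_min
          (\<lambda>g. g \<bullet> ((\<Sum>i=1..<t. x i w) - C *\<^sub>R (\<Sum>i=t+1..T. eps t i w *\<^sub>R z t i w)))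
          (\<lambda>g. g \<in> l1_ball) (f t w)"
  shows "(\<integral>w. regret T (\<lambda>t. f t w) (\<lambda>t. x t w) \<partial>M)
    \<le> C * (\<integral>v. (\<integral>e. infnorm (\<Sum>t=1..T. e t *\<^sub>R v t) \<partial>Pi\<^sub>M {1..T} (\<lambda>_. rademacher))
            \<partial>Pi\<^sub>M {1..T} (\<lambda>_. iid_vector D :: (real ^ 'n) measure))
      + 4 * (\<Sum>t=1..T. measure (Pi\<^sub>M {t+1..T} (\<lambda>_. D))
          {y \<in> space (Pi\<^sub>M {t+1..T} (\<lambda>_. D)). C * \<bar>\<Sum>i=t+1..T. y i\<bar> \<le> 4})"
proof -
  interpret M: prob_space M by fact
  interpret D: real_distribution D by fact
  have C6: "4 \<le> \<bar>C\<bar> * (\<integral>u. \<bar>u\<bar> \<partial>D)" and Cpos: "0 \<le> C"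
    using D_moment(2) by (auto simp: C)
  define B where "B = C * (\<integral>v. (\<integral>e. infnorm (\<Sum>t=1..T. e t *\<^sub>R v t) \<partial>Pi\<^sub>M {1..T} (\<lambda>_. rademacher))
            \<partial>Pi\<^sub>M {1..T} (\<lambda>_. iid_vector D :: (real ^ 'n) measure))"
  have B0: "0 \<le> B"
    unfolding B_def by (intro mult_nonneg_nonneg Cpos Bochner_Integration.integral_nonneg infnorm_pos_le)
  define S where "S t w = (\<Sum>i=1..t. x i w)" for t w
  define N where "N t w = noise {t+1..T} (\<lambda>i\<in>{t+1..T}. eps t i w, \<lambda>i\<in>{t+1..T}. z t i w)" for t w
  \<comment> \<open>The noise here is an independent copy, whereas \<open>N t\<close> is built from
    the learner's actual draws.\<close>
  define \<Phi> where "\<Phi> t = (\<integral>\<^sup>+w. (\<integral>\<^sup>+q. ennreal (infnorm (S t w - C *\<^sub>R noise {t+1..T} q))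
      \<partial>draw_law D {t+1..T}) \<partial>M)" for t
  have meas [measurable]: "x t \<in> borel_measurable M" "f t \<in> borel_measurable M" if "t \<in> {1..T}" for t
    using nature learner that by auto
  have f1: "f t w \<in> l1_ball" if "t \<in> {1..T}" "w \<in> space M" for t w
    using learner(2)[OF that] by (simp add: is_arg_min_linorder)
  have fx: "\<bar>f t w \<bullet> x t w\<bar> \<le> 1" if "t \<in> {1..T}" "w \<in> space M" for t w
    using inner_l1_ball_bound[OF f1[OF that], of "x t w"] nature(2)[OF that]
    by (simp add: linf_ball_def)
  txt \<open>Adding 1 makes the losses nonnegative, so that all potentials can be handled as
    extended nonnegative integrals.\<close>
  have step: "(\<integral>\<^sup>+w. ennreal (1 + f t w \<bullet> x t w) \<partial>M) + \<Phi> t \<le> 1 + \<Phi> (t - 1)"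
    if t: "t \<in> {1..T}" for t
  proof -
    interpret Q: prob_space "draw_law D {t+1..T} :: ((nat \<Rightarrow> real) \<times> (nat \<Rightarrow> real ^ 'n)) measure"
      by (rule D.prob_space_draw_law)
    note [measurable] = meas[OF t]
    \<comment> \<open>Nature's earlier moves must be read off the history, since
      \<open>fresh\<close> speaks of functions of \<open>moves_upto t f x\<close>.\<close>
    define past where "past m = (\<Sum>s\<in>{1..<t}. snd (fst m s))"
      for m :: "(nat \<Rightarrow> (real ^ 'n) \<times> (real ^ 'n)) \<times> (real ^ 'n)"
    have [measurable]: "past \<in> borel_measurable (moves_space t)" "snd \<in> borel_measurable (moves_space t)"
      unfolding past_def moves_space_def by (auto intro!: borel_measurable_sum simp: borel_prod[symmetric])
    have past: "past (moves_upto t f x w) = S (t - 1) w" "snd (moves_upto t f x w) = x t w" for w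
      using t by (auto simp: past_def moves_upto_def S_def intro!: sum.cong)
    have S: "S t w = S (t - 1) w + x t w" for w
      using t by (cases t) (auto simp: S_def)
    have N: "N t w = (\<Sum>i=t+1..T. eps t i w *\<^sub>R z t i w)" for w
      by (simp add: N_def noise_def)
    have "{1..<t} = {1..t - 1}"
      using t by auto
    then have argmin: "is_arg_min (\<lambda>g. g \<bullet> (S (t - 1) w - C *\<^sub>R N t w)) (\<lambda>g. g \<in> l1_ball) (f t w)"
      if "w \<in> space M" for w
      using learner(2)[OF t that] by (simp add: N S_def)
    have draws: "(\<lambda>w. (\<lambda>i\<in>{t+1..T}. eps t i w, \<lambda>i\<in>{t+1..T}. z t i w)) \<in> M \<rightarrow>\<^sub>M draw_law D {t+1..T}"
      using fresh[OF t] unfolding fresh_sample_def by blast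
    then have [measurable]: "N t \<in> borel_measurable M"
      unfolding N_def[abs_def] by (rule measurable_compose[OF _ noise_measurable])
    have [measurable]: "S j \<in> borel_measurable M" if "j \<le> T" for j
      unfolding S_def[abs_def] using that by (intro borel_measurable_sum meas) auto
    have [measurable]: "S t \<in> borel_measurable M" "S (t - 1) \<in> borel_measurable M"
      using t by auto
    \<comment> \<open>The history includes Nature's move of round \<open>t\<close>, so the draw is
      independent of \<open>S t\<close> and may replace the copy.\<close>
    have \<Phi>t: "\<Phi> t = (\<integral>\<^sup>+w. ennreal (infnorm (S t w - C *\<^sub>R N t w)) \<partial>M)"
      using fresh_sample_nn_integral[OF fresh[OF t] Q.sigma_finite_measure_axioms,
          of "\<lambda>m q. ennreal (infnorm (past m + snd m - C *\<^sub>R noise {t+1..T} q))"]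
      by (simp add: \<Phi>_def past S N_def)
    \<comment> \<open>The earlier potential carries one more noise index, \<open>t\<close>.
      Integrating it out leaves the index set of the round-\<open>t\<close> draw, so both potentials
      are written with the same \<open>N t\<close>.\<close>
    have "{t - 1 + 1..T} = insert t {t+1..T}"
      using t by auto
    then have "\<Phi> (t - 1) = (\<integral>\<^sup>+w. (\<integral>\<^sup>+q. perturbed_norm D C (S (t - 1) w - C *\<^sub>R noise {t+1..T} q)
        \<partial>draw_law D {t+1..T}) \<partial>M)"
      unfolding \<Phi>_def by (simp only:) (subst D.nn_integral_draw_law_perturbed_norm, auto)
    also have "\<dots> = (\<integral>\<^sup>+w. perturbed_norm D C (S (t - 1) w - C *\<^sub>R N t w) \<partial>M)"
      using fresh_sample_nn_integral[OF fresh[OF t] Q.sigma_finite_measure_axioms,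
          of "\<lambda>m q. perturbed_norm D C (past m - C *\<^sub>R noise {t+1..T} q)"]
      by (simp add: past N_def)
    finally have \<Phi>t': "\<Phi> (t - 1) = (\<integral>\<^sup>+w. perturbed_norm D C (S (t - 1) w - C *\<^sub>R N t w) \<partial>M)" .
    have "(\<integral>\<^sup>+w. ennreal (1 + f t w \<bullet> x t w) \<partial>M) + \<Phi> t
        = (\<integral>\<^sup>+w. ennreal (1 + f t w \<bullet> x t w) + ennreal (infnorm (S t w - C *\<^sub>R N t w)) \<partial>M)"
      unfolding \<Phi>t by (intro nn_integral_add[symmetric]) auto
    also have "\<dots> \<le> (\<integral>\<^sup>+w. 1 + perturbed_norm D C (S (t - 1) w - C *\<^sub>R N t w) \<partial>M)"
    proof (intro nn_integral_mono)
      fix w assume w: "w \<in> space M"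
      define W where "W = S (t - 1) w - C *\<^sub>R N t w"
      have "ennreal (1 + f t w \<bullet> x t w) + ennreal (infnorm (S t w - C *\<^sub>R N t w))
          = ennreal (1 + (f t w \<bullet> x t w + infnorm (W + x t w)))"
        using fx[OF t w] by (simp add: S W_def infnorm_pos_le algebra_simps flip: ennreal_plus)
      \<comment> \<open>An inequality avoids settling the sign of the argument, which
        \<open>ennreal\<close> truncates at 0.\<close>
      also have "\<dots> \<le> 1 + ennreal (f t w \<bullet> x t w + infnorm (W + x t w))"
        by (metis ennreal_1 ennreal_leI ennreal_plus ennreal_neg add_0_right linorder_linear add_left_mono zero_le_one add.right_neutral)
      also have "\<dots> \<le> 1 + perturbed_norm D C W"
        using argmin[OF w] nature(2)[OF t w] unfolding W_def
        by (intro add_left_mono D.follow_perturbed_leader_step D D_moment C6)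
      finally show "ennreal (1 + f t w \<bullet> x t w) + ennreal (infnorm (S t w - C *\<^sub>R N t w))
          \<le> 1 + perturbed_norm D C (S (t - 1) w - C *\<^sub>R N t w)"
        by (simp add: W_def)
    qed
    also have "\<dots> = 1 + \<Phi> (t - 1)"
      unfolding \<Phi>t' by (subst nn_integral_add) (measurable, simp add: M.emeasure_space_1)
    finally show ?thesis .
  qed
  have telescope: "(\<Sum>t=1..k. \<integral>\<^sup>+w. ennreal (1 + f t w \<bullet> x t w) \<partial>M) + \<Phi> k \<le> of_nat k + \<Phi> 0"
    if "k \<le> T" for k
    using that
  proof (induction k)
    case (Suc k)
    have "(\<Sum>t=1..Suc k. \<integral>\<^sup>+w. ennreal (1 + f t w \<bullet> x t w) \<partial>M) + \<Phi> (Suc k)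
        = (\<Sum>t=1..k. \<integral>\<^sup>+w. ennreal (1 + f t w \<bullet> x t w) \<partial>M)
          + ((\<integral>\<^sup>+w. ennreal (1 + f (Suc k) w \<bullet> x (Suc k) w) \<partial>M) + \<Phi> (Suc k))"
      by (simp add: add.assoc)
    also have "\<dots> \<le> (\<Sum>t=1..k. \<integral>\<^sup>+w. ennreal (1 + f t w \<bullet> x t w) \<partial>M) + (1 + \<Phi> k)"
      using step[of "Suc k"] Suc.prems by (intro add_left_mono) auto
    also have "\<dots> = 1 + ((\<Sum>t=1..k. \<integral>\<^sup>+w. ennreal (1 + f t w \<bullet> x t w) \<partial>M) + \<Phi> k)"
      by (simp add: ac_simps)
    also have "\<dots> \<le> 1 + (of_nat k + \<Phi> 0)"
      using Suc by (intro add_left_mono) auto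
    finally show ?case by (simp add: ac_simps)
  qed simp
  have \<Phi>0: "\<Phi> 0 = ennreal B"
  proof -
    have "\<Phi> 0 = (\<integral>\<^sup>+q. ennreal C * ennreal (infnorm (noise {1..T} q :: real ^ 'n)) \<partial>draw_law D {1..T})"
      using Cpos by (simp add: \<Phi>_def S_def infnorm_neg infnorm_mul M.emeasure_space_1 ennreal_mult infnorm_pos_le)
    also have "\<dots> = ennreal B"
      using Cpos by (subst nn_integral_cmult)
        (auto simp: D.nn_integral_noise[OF D_moment(1)] B_def infnorm_pos_le ennreal_mult)
    finally show ?thesis .
  qed
  interpret Q: prob_space "draw_law D {T+1..T} :: ((nat \<Rightarrow> real) \<times> (nat \<Rightarrow> real ^ 'n)) measure"
    by (rule D.prob_space_draw_law)
  \<comment> \<open>The index set \<open>{T+1..T}\<close> is empty, so no noise remains.\<close>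
  have \<Phi>T: "\<Phi> T = (\<integral>\<^sup>+w. ennreal (infnorm (S T w)) \<partial>M)"
    using Q.emeasure_space_1 by (simp add: \<Phi>_def noise_def)
  \<comment> \<open>A nonnegative majorant of the regret plus \<open>T\<close>; its finite extended
    integral yields integrability and the return to real integrals.\<close>
  define H where "H w = (\<Sum>t=1..T. 1 + f t w \<bullet> x t w) + infnorm (S T w)" for w
  have [measurable]: "S T \<in> borel_measurable M" "H \<in> borel_measurable M"
    unfolding H_def[abs_def] S_def[abs_def] by (intro borel_measurable_add borel_measurable_sum; measurable; fail)+
  have nonneg: "0 \<le> 1 + f t w \<bullet> x t w" if "t \<in> {1..T}" "w \<in> space M" for t w
    using fx[OF that] by linarith
  have H0: "0 \<le> H w" if "w \<in> space M" for w
    unfolding H_def using that by (intro add_nonneg_nonneg sum_nonneg nonneg infnorm_pos_le)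
  have "(\<integral>\<^sup>+w. ennreal (H w) \<partial>M)
      = (\<integral>\<^sup>+w. (\<Sum>t=1..T. ennreal (1 + f t w \<bullet> x t w)) + ennreal (infnorm (S T w)) \<partial>M)"
  proof (intro nn_integral_cong)
    fix w assume w: "w \<in> space M"
    have "ennreal (H w) = ennreal (\<Sum>t=1..T. 1 + f t w \<bullet> x t w) + ennreal (infnorm (S T w))"
      unfolding H_def by (intro ennreal_plus sum_nonneg nonneg w infnorm_pos_le)
    also have "ennreal (\<Sum>t=1..T. 1 + f t w \<bullet> x t w) = (\<Sum>t=1..T. ennreal (1 + f t w \<bullet> x t w))"
      by (intro sum_ennreal[symmetric] nonneg w)
    finally show "ennreal (H w) = (\<Sum>t=1..T. ennreal (1 + f t w \<bullet> x t w)) + ennreal (infnorm (S T w))" .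
  qed
  also have "\<dots> = (\<Sum>t=1..T. \<integral>\<^sup>+w. ennreal (1 + f t w \<bullet> x t w) \<partial>M) + \<Phi> T"
    unfolding \<Phi>T
    by (subst nn_integral_add, (measurable; fail)+, subst nn_integral_sum)
       (auto intro!: borel_measurable_add borel_measurable_inner measurable_ennreal)
  also have "\<dots> \<le> of_nat T + ennreal B"
    using telescope[of T] \<Phi>0 by simp
  finally have nnH: "(\<integral>\<^sup>+w. ennreal (H w) \<partial>M) \<le> ennreal (real T + B)"
    using B0 by (simp add: ennreal_of_nat_eq_real_of_nat)
  then have intH: "integrable M H"
    using H0 by (intro integrableI_nonneg) (auto intro: le_less_trans)
  have "(\<integral>\<^sup>+w. ennreal (H w) \<partial>M) = ennreal (\<integral>w. H w \<partial>M)"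
    using H0 by (intro nn_integral_eq_integral intH) auto
  with nnH have EH: "(\<integral>w. H w \<partial>M) \<le> real T + B"
    using B0 by (simp del: ennreal_plus)
  have "(\<integral>w. regret T (\<lambda>t. f t w) (\<lambda>t. x t w) \<partial>M) \<le> B"
  proof (cases "integrable M (\<lambda>w. regret T (\<lambda>t. f t w) (\<lambda>t. x t w))")
    case True
    have "(\<integral>w. regret T (\<lambda>t. f t w) (\<lambda>t. x t w) \<partial>M) \<le> (\<integral>w. H w - real T \<partial>M)"
      using regret_le[of T]
      by (intro integral_mono True Bochner_Integration.integrable_diff intH) (auto simp: H_def S_def sum.distrib)
    also have "\<dots> = (\<integral>w. H w \<partial>M) - real T"
      using intH by (simp add: M.prob_space)
    finally show ?thesis using EH by linarith
  next
    \<comment> \<open>A non-integrable function has Bochner integral 0, which is at most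
      \<open>B\<close>.\<close>
    case False
    then show ?thesis using B0 by (simp add: not_integrable_integral_eq)
  qed
  \<comment> \<open>The other summand is four times a sum of probabilities, hence
    nonnegative.\<close>
  then show ?thesis
    unfolding B_def by (rule order_trans) (simp add: sum_nonneg)
qed

end
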